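(* Let $R$ be a commutative ring with unity, $Y\subseteq\mathrm{Spec}(R)$, and let $\{J_i\}_{i=1}^n$ be a finite family of strong $\mathcal{H}_Y$-ideals of $R$. Then $\prod_{i=1}^nJ_i$ is a strong $\mathcal{H}_Y$-ideal if and only if $\bigcap_{i=1}^nJ_i=\prod_{i=1}^nJ_i$. The same statement holds with "strong $\mathcal{H}_Y$-ideal" replaced throughout by "$\mathcal{H}_Y$-ideal", and with "strong $\mathcal{H}_Y$-ideal" replaced throughout by "$Y$-Hilbert ideal".
   Context: $h_Y(S)=\{P\in Y: S\subseteq P\}$ for $S\subseteq R$, $h_Y(a)=h_Y(\{a\})$, and for $X\subseteq Y$, $k(X)=\bigcap_{P\in X}P$ (with $k(\emptyset)=R$); $kh_Y(S)=k(h_Y(S))$. An ideal $I$ of $R$ (not necessarily proper) is an $\mathcal{H}_Y$-ideal if $a\in I$, $b\in R$ and $h_Y(a)\subseteq h_Y(b)$ imply $b\in I$. It is a strong $\mathcal{H}_Y$-ideal if for every finite subset $F\subseteq I$ and every $b\in R$, $h_Y(F)\subseteq h_Y(b)$ implies $b\in I$. It is a $Y$-Hilbert ideal if $I=kh_Y(I)$. *)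

theory Defs
  imports "HOL-Algebra.Ideal_Product"
begin

definition Spec :: "('a, 'm) ring_scheme \<Rightarrow> 'a set set"
  where "Spec R = {P. primeideal P R}"

definition hull_in :: "'a set set \<Rightarrow> 'a set \<Rightarrow> 'a set set"
  where "hull_in Y S = {P \<in> Y. S \<subseteq> P}"

text \<open>Intersecting with the carrier gives the convention that the kernel of the empty
  family is the whole ring; it has no effect on nonempty families of ideals.\<close>

definition kernel_of :: "('a, 'm) ring_scheme \<Rightarrow> 'a set set \<Rightarrow> 'a set"
  where "kernel_of R X = carrier R \<inter> (\<Inter>P\<in>X. P)"

definition H_ideal :: "('a, 'm) ring_scheme \<Rightarrow> 'a set set \<Rightarrow> 'a set \<Rightarrow> bool"
  where "H_ideal R Y I \<longleftrightarrow> ideal I R \<and>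
    (\<forall>a\<in>I. \<forall>b\<in>carrier R. hull_in Y {a} \<subseteq> hull_in Y {b} \<longrightarrow> b \<in> I)"

definition strong_H_ideal :: "('a, 'm) ring_scheme \<Rightarrow> 'a set set \<Rightarrow> 'a set \<Rightarrow> bool"
  where "strong_H_ideal R Y I \<longleftrightarrow> ideal I R \<and>
    (\<forall>F. finite F \<and> F \<subseteq> I \<longrightarrow>
      (\<forall>b\<in>carrier R. hull_in Y F \<subseteq> hull_in Y {b} \<longrightarrow> b \<in> I))"

definition Hilbert_ideal :: "('a, 'm) ring_scheme \<Rightarrow> 'a set set \<Rightarrow> 'a set \<Rightarrow> bool"
  where "Hilbert_ideal R Y I \<longleftrightarrow> ideal I R \<and> I = kernel_of R (hull_in Y I)"

text \<open>The product of a finite family is taken in the commutative monoid of ideals of the ring,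
  with unit the whole ring. For the empty family the product is therefore the whole ring, and
  so is the intersection, by the same convention as for the kernel.\<close>

definition ideal_family_prod :: "('a, 'm) ring_scheme \<Rightarrow> nat \<Rightarrow> (nat \<Rightarrow> 'a set) \<Rightarrow> 'a set"
  where "ideal_family_prod R n J = (\<Otimes>\<^bsub>ideals_set R\<^esub> i\<in>{1..n}. J i)"

definition ideal_family_inter :: "('a, 'm) ring_scheme \<Rightarrow> nat \<Rightarrow> (nat \<Rightarrow> 'a set) \<Rightarrow> 'a set"
  where "ideal_family_inter R n J = carrier R \<inter> (\<Inter>i\<in>{1..n}. J i)"

end

theory Submission
  imports Defs
begin

text \<open>All three kinds of ideals are \<open>\<H>\<^sub>Y\<close>-ideals and are stable under finite
  intersections, so the intersection inherits the property from the family. Conversely, if \<open>b\<close> lies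
  in every member of a family of \<open>n\<close> ideals, then \<open>b\<^sup>n\<close> lies in their product; as \<open>b\<close> and
  \<open>b\<^sup>n\<close> lie in the same primes, an \<open>\<H>\<^sub>Y\<close>-ideal containing the product contains \<open>b\<close>.\<close>

lemma primeideal_nat_powD:
  fixes R (structure)
  assumes "primeideal P R" "b \<in> carrier R" "b [^] (n::nat) \<in> P"
  shows "b \<in> P"
proof -
  interpret primeideal P R by fact
  show ?thesis
    using assms(3)
  proof (induction n)
    case 0
    then show ?case
      \<comment> \<open>A prime ideal is proper, so it cannot contain \<open>b [^] 0\<close>, which
        is \<open>\<one>\<close>.\<close>
      using one_imp_carrier I_notcarr by simp
  next
    case (Suc n)
    then show ?case
      using I_prime[of "b [^] n" b] assms(2) by auto
  qed
qed

text \<open>Every prime in \<open>Y\<close> that contains \<open>b [^] n\<close> contains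
  \<open>b\<close>, which is exactly the hull condition for passing from the power to
  \<open>b\<close>. The exponent 0 is allowed because the empty family needs it: the hull of
  \<open>\<one>\<close> is empty.\<close>

lemma H_ideal_nat_powD:
  fixes R (structure)
  assumes "Y \<subseteq> Spec R" "H_ideal R Y I" "b \<in> carrier R" "b [^] (n::nat) \<in> I"
  shows "b \<in> I"
proof -
  have "hull_in Y {b [^] n} \<subseteq> hull_in Y {b}"
    using assms(1,3) primeideal_nat_powD[of _ R b n] unfolding hull_in_def Spec_def by auto
  then show ?thesis
    using assms(2-4) unfolding H_ideal_def by blast
qed

lemma (in cring) ideal_carrier_Inter:
  assumes "\<And>i. i \<in> A \<Longrightarrow> ideal (J i) R"
  shows "ideal (carrier R \<inter> (\<Inter>i\<in>A. J i)) R"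
  \<comment> \<open>Inserting the whole ring keeps the family of ideals nonempty when
    \<open>A\<close> is empty.\<close>
  using i_Intersect[of "insert (carrier R) (J ` A)"] assms oneideal by auto

text \<open>The three claims share one induction: at an insertion, bounding the product by the
  intersection uses that the product over \<open>A\<close> is already an ideal. The exponent
  \<open>card A\<close> counts one factor \<open>b\<close> for each index.\<close>

lemma (in cring) finprod_ideals_set_props:
  assumes "finite A" "\<And>i. i \<in> A \<Longrightarrow> ideal (J i) R"
  shows ideal_finprod_ideals_set: "ideal (\<Otimes>\<^bsub>ideals_set R\<^esub> i\<in>A. J i) R" (is ?ideal)
    and finprod_ideals_set_subset_Inter:
      "(\<Otimes>\<^bsub>ideals_set R\<^esub> i\<in>A. J i) \<subseteq> carrier R \<inter> (\<Inter>i\<in>A. J i)" (is ?sub)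
    and nat_pow_card_in_finprod_ideals_set:
      "b \<in> carrier R \<inter> (\<Inter>i\<in>A. J i) \<Longrightarrow> b [^] card A \<in> (\<Otimes>\<^bsub>ideals_set R\<^esub> i\<in>A. J i)"
      (is "?mem \<Longrightarrow> ?pow")
proof -
  interpret ISet: comm_monoid "ideals_set R"
    by (rule ideals_set_is_comm_monoid)
  have "?ideal \<and> ?sub \<and> (?mem \<longrightarrow> ?pow)"
    using assms
  proof (induction A)
    case empty
    \<comment> \<open>The unit of the monoid of ideals is the whole ring, which is also the value of
      the empty intersection once it is cut down to \<open>carrier R\<close>.\<close>
    have "(\<Otimes>\<^bsub>ideals_set R\<^esub> i\<in>{}. J i) = carrier R"
      by (simp only: ISet.finprod_empty) (simp add: ideals_set_def)
    then show ?case
      using oneideal by simp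
  next
    case (insert a A)
    let ?P = "\<Otimes>\<^bsub>ideals_set R\<^esub> i\<in>A. J i"
    have ideals: "ideal (J i) R" if "i \<in> insert a A" for i
      using insert.prems that by blast
    then have Ja: "ideal (J a) R"
      by blast
    have "ideal ?P R \<and> ?P \<subseteq> carrier R \<inter> (\<Inter>i\<in>A. J i) \<and>
        (b \<in> carrier R \<inter> (\<Inter>i\<in>A. J i) \<longrightarrow> b [^] card A \<in> ?P)"
      by (rule insert.IH) (rule ideals, rule insertI2)
    then have P: "ideal ?P R" "?P \<subseteq> carrier R \<inter> (\<Inter>i\<in>A. J i)"
      and pow: "b \<in> carrier R \<inter> (\<Inter>i\<in>A. J i) \<Longrightarrow> b [^] card A \<in> ?P"
      by blast+
    have "J \<in> A \<rightarrow> carrier (ideals_set R)" "J a \<in> carrier (ideals_set R)"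
      using ideals by (auto simp: ideals_set_def)
    then have "(\<Otimes>\<^bsub>ideals_set R\<^esub> i\<in>insert a A. J i) = J a \<otimes>\<^bsub>ideals_set R\<^esub> ?P"
      by (rule ISet.finprod_insert[OF insert.hyps])
    then have eq: "(\<Otimes>\<^bsub>ideals_set R\<^esub> i\<in>insert a A. J i) = J a \<cdot> ?P"
      by (simp add: ideals_set_def)
    have "b [^] card (insert a A) \<in> J a \<cdot> ?P" if b: "b \<in> carrier R \<inter> (\<Inter>i\<in>insert a A. J i)"
    proof -
      \<comment> \<open>The first factor lies in \<open>J a\<close> and the second in
        \<open>?P\<close>, so this is a generator of the product ideal.\<close>
      have "b \<otimes> b [^] card A \<in> J a \<cdot> ?P"
        using b pow by (intro ideal_prod.prod) auto
      then show ?thesis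
        using b insert.hyps by (simp add: m_comm)
    qed
    then show ?case
      using ideal_prod_is_ideal[OF Ja P(1)] ideal_prod_inter[OF Ja P(1)] P(2) unfolding eq by blast
  qed
  then show ?ideal ?sub "?mem \<Longrightarrow> ?pow"
    by auto
qed

lemma strong_H_ideal_imp_H_ideal:
  assumes "strong_H_ideal R Y I"
  shows "H_ideal R Y I"
  unfolding H_ideal_def
proof (intro conjI ballI impI)
  show "ideal I R"
    using assms unfolding strong_H_ideal_def by blast
  show "b \<in> I" if "a \<in> I" "b \<in> carrier R" "hull_in Y {a} \<subseteq> hull_in Y {b}" for a b
    using assms that unfolding strong_H_ideal_def by (auto dest!: spec[of _ "{a}"])
qed

text \<open>Each member of \<open>hull_in Y I\<close> contains \<open>a\<close> and hence
  \<open>b\<close>, so \<open>b\<close> lies in the kernel of that hull, which is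
  \<open>I\<close>.\<close>

lemma Hilbert_ideal_imp_H_ideal:
  assumes "Hilbert_ideal R Y I"
  shows "H_ideal R Y I"
  unfolding H_ideal_def
proof (intro conjI ballI impI)
  show "ideal I R"
    using assms unfolding Hilbert_ideal_def by blast
  fix a b
  assume "a \<in> I" "b \<in> carrier R" "hull_in Y {a} \<subseteq> hull_in Y {b}"
  then have "b \<in> kernel_of R (hull_in Y I)"
    unfolding kernel_of_def hull_in_def by blast
  then show "b \<in> I"
    using assms unfolding Hilbert_ideal_def by blast
qed

lemma (in cring) H_ideal_Inter:
  assumes "\<And>i. i \<in> A \<Longrightarrow> H_ideal R Y (J i)"
  shows "H_ideal R Y (carrier R \<inter> (\<Inter>i\<in>A. J i))"
  using ideal_carrier_Inter[of A J] assms unfolding H_ideal_def by blast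

text \<open>A finite \<open>F\<close> inside the intersection lies in every \<open>J i\<close>, so
  the same \<open>F\<close> serves for all members at once.\<close>

lemma (in cring) strong_H_ideal_Inter:
  assumes "\<And>i. i \<in> A \<Longrightarrow> strong_H_ideal R Y (J i)"
  shows "strong_H_ideal R Y (carrier R \<inter> (\<Inter>i\<in>A. J i))"
  using ideal_carrier_Inter[of A J] assms
  unfolding strong_H_ideal_def le_inf_iff le_INF_iff by blast

text \<open>Taking the kernel of the hull is monotone, so for the intersection it stays inside the
  corresponding kernel for each \<open>J i\<close>, which is \<open>J i\<close> itself.\<close>

lemma (in cring) Hilbert_ideal_Inter:
  assumes "\<And>i. i \<in> A \<Longrightarrow> Hilbert_ideal R Y (J i)"
  shows "Hilbert_ideal R Y (carrier R \<inter> (\<Inter>i\<in>A. J i))" (is "Hilbert_ideal R Y ?I")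
proof -
  have "ideal ?I R"
    using ideal_carrier_Inter[of A J] assms unfolding Hilbert_ideal_def by blast
  moreover have "kernel_of R (hull_in Y ?I) \<subseteq> J i" if "i \<in> A" for i
  proof -
    have "kernel_of R (hull_in Y ?I) \<subseteq> kernel_of R (hull_in Y (J i))"
      using that unfolding kernel_of_def hull_in_def by blast
    then show ?thesis
      using assms[OF that] unfolding Hilbert_ideal_def by simp
  qed
  moreover have "kernel_of R (hull_in Y ?I) \<subseteq> carrier R" "?I \<subseteq> kernel_of R (hull_in Y ?I)"
    unfolding kernel_of_def hull_in_def by auto
  ultimately show ?thesis
    unfolding Hilbert_ideal_def by blast
qed

text \<open>The predicate \<open>Q\<close> stands for any of the three notions, and \<open>H\<close>
  and \<open>Inter\<close> isolate what has to be checked for each. The forward direction rests on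
  \<open>H\<close>, the backward one on \<open>Inter\<close>.\<close>

lemma (in cring) finprod_ideals_set_iff_eq_Inter:
  assumes "Y \<subseteq> Spec R" "finite A" "\<And>i. i \<in> A \<Longrightarrow> Q (J i)"
    and H: "\<And>I. Q I \<Longrightarrow> H_ideal R Y I"
    and Inter: "Q (carrier R \<inter> (\<Inter>i\<in>A. J i))"
  shows "Q (\<Otimes>\<^bsub>ideals_set R\<^esub> i\<in>A. J i) \<longleftrightarrow>
    carrier R \<inter> (\<Inter>i\<in>A. J i) = (\<Otimes>\<^bsub>ideals_set R\<^esub> i\<in>A. J i)"
proof
  have ideals: "ideal (J i) R" if "i \<in> A" for i
    using H[OF assms(3)[OF that]] unfolding H_ideal_def by blast
  assume Q: "Q (\<Otimes>\<^bsub>ideals_set R\<^esub> i\<in>A. J i)"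
  show "carrier R \<inter> (\<Inter>i\<in>A. J i) = (\<Otimes>\<^bsub>ideals_set R\<^esub> i\<in>A. J i)"
  proof (intro subset_antisym subsetI)
    fix b
    assume b: "b \<in> carrier R \<inter> (\<Inter>i\<in>A. J i)"
    have "b [^] card A \<in> (\<Otimes>\<^bsub>ideals_set R\<^esub> i\<in>A. J i)"
      using assms(2) ideals b by (rule nat_pow_card_in_finprod_ideals_set)
    then show "b \<in> (\<Otimes>\<^bsub>ideals_set R\<^esub> i\<in>A. J i)"
      \<comment> \<open>Here \<open>H\<close> is applied to the product itself, so that
        \<open>b\<close> can be recovered from its power.\<close>
      using H_ideal_nat_powD[OF assms(1) H[OF Q]] b by blast
  next
    show "b \<in> carrier R \<inter> (\<Inter>i\<in>A. J i)" if "b \<in> (\<Otimes>\<^bsub>ideals_set R\<^esub> i\<in>A. J i)" for b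
      using finprod_ideals_set_subset_Inter[of A J, OF assms(2) ideals] that by (rule subsetD)
  qed
next
  assume "carrier R \<inter> (\<Inter>i\<in>A. J i) = (\<Otimes>\<^bsub>ideals_set R\<^esub> i\<in>A. J i)"
  then show "Q (\<Otimes>\<^bsub>ideals_set R\<^esub> i\<in>A. J i)"
    using Inter by simp
qed

theorem proposition6p1:
  fixes R :: "('a, 'm) ring_scheme" and Y :: "'a set set"
    and n :: nat and J :: "nat \<Rightarrow> 'a set"
  assumes "cring R" and "Y \<subseteq> Spec R"
  shows "((\<forall>i\<in>{1..n}. strong_H_ideal R Y (J i)) \<longrightarrow>
            (strong_H_ideal R Y (ideal_family_prod R n J) \<longleftrightarrow>
             ideal_family_inter R n J = ideal_family_prod R n J))
       \<and> ((\<forall>i\<in>{1..n}. H_ideal R Y (J i)) \<longrightarrow>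
            (H_ideal R Y (ideal_family_prod R n J) \<longleftrightarrow>
             ideal_family_inter R n J = ideal_family_prod R n J))
       \<and> ((\<forall>i\<in>{1..n}. Hilbert_ideal R Y (J i)) \<longrightarrow>
            (Hilbert_ideal R Y (ideal_family_prod R n J) \<longleftrightarrow>
             ideal_family_inter R n J = ideal_family_prod R n J))"
proof -
  interpret cring R by fact
  note iff = finprod_ideals_set_iff_eq_Inter[OF assms(2) finite_atLeastAtMost, of 1 n _ J]
  show ?thesis
    unfolding ideal_family_prod_def ideal_family_inter_def
  proof (intro conjI impI)
    assume "\<forall>i\<in>{1..n}. strong_H_ideal R Y (J i)"
    then have J: "strong_H_ideal R Y (J i)" if "i \<in> {1..n}" for i
      using that by blast
    show "strong_H_ideal R Y (\<Otimes>\<^bsub>ideals_set R\<^esub> i\<in>{1..n}. J i) \<longleftrightarrow>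
        carrier R \<inter> (\<Inter>i\<in>{1..n}. J i) = (\<Otimes>\<^bsub>ideals_set R\<^esub> i\<in>{1..n}. J i)"
      by (rule iff[where Q = "strong_H_ideal R Y",
            OF J strong_H_ideal_imp_H_ideal strong_H_ideal_Inter[OF J]])
  next
    assume "\<forall>i\<in>{1..n}. H_ideal R Y (J i)"
    then have J: "H_ideal R Y (J i)" if "i \<in> {1..n}" for i
      using that by blast
    show "H_ideal R Y (\<Otimes>\<^bsub>ideals_set R\<^esub> i\<in>{1..n}. J i) \<longleftrightarrow>
        carrier R \<inter> (\<Inter>i\<in>{1..n}. J i) = (\<Otimes>\<^bsub>ideals_set R\<^esub> i\<in>{1..n}. J i)"
      \<comment> \<open>For this choice of \<open>Q\<close> the implication \<open>H\<close> is a
        tautology, left open as \<open>_\<close>.\<close>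
      by (rule iff[where Q = "H_ideal R Y", OF J _ H_ideal_Inter[OF J]])
  next
    assume "\<forall>i\<in>{1..n}. Hilbert_ideal R Y (J i)"
    then have J: "Hilbert_ideal R Y (J i)" if "i \<in> {1..n}" for i
      using that by blast
    show "Hilbert_ideal R Y (\<Otimes>\<^bsub>ideals_set R\<^esub> i\<in>{1..n}. J i) \<longleftrightarrow>
        carrier R \<inter> (\<Inter>i\<in>{1..n}. J i) = (\<Otimes>\<^bsub>ideals_set R\<^esub> i\<in>{1..n}. J i)"
      by (rule iff[where Q = "Hilbert_ideal R Y",
            OF J Hilbert_ideal_imp_H_ideal Hilbert_ideal_Inter[OF J]])
  qed
qed

end
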